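(* Let $m \le n$ be positive integers with $m+n\ge 3$. Then $A(m,n) \leq m$.
   Context: For disjoint finite sets $\mathcal{P}, \mathcal{Q} \subset \mathbb{R}^2$, $A(\mathcal{P}, \mathcal{Q})$ denotes the number of distinct values in $(0,\pi)$ of angles whose central vertex lies in one of the two sets and whose two (distinct) endpoints both lie in the other set. $A(m,n)$ is the minimum of $A(\mathcal{P},\mathcal{Q})$ over all such pairs with $|\mathcal{P}|=m$, $|\mathcal{Q}|=n$ and $\mathcal{P}\cup\mathcal{Q}$ not all collinear. *)

theory Defs
  imports "HOL-Analysis.Analysis"
begin

text \<open>The unoriented angle at the vertex \<open>c\<close> between the rays towards \<open>a\<close> and \<open>b\<close>, a value in
  \<open>[0, \<pi>]\<close>; only meaningful for \<open>a \<noteq> c\<close> and \<open>b \<noteq> c\<close>, which disjointness of the two point sets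
  guarantees below.\<close>

definition angle_at :: "real^2 \<Rightarrow> real^2 \<Rightarrow> real^2 \<Rightarrow> real" where
  "angle_at a c b = arccos (((a - c) \<bullet> (b - c)) / (norm (a - c) * norm (b - c)))"

definition centred_angles :: "(real^2) set \<Rightarrow> (real^2) set \<Rightarrow> real set" where
  "centred_angles C E = {angle_at a c b | a c b. c \<in> C \<and> a \<in> E \<and> b \<in> E \<and> a \<noteq> b}"

definition num_bipartite_angles :: "(real^2) set \<Rightarrow> (real^2) set \<Rightarrow> nat" where
  "num_bipartite_angles P Q =
     card ((centred_angles P Q \<union> centred_angles Q P) \<inter> {0<..<pi})"

definition admissible_pair :: "nat \<Rightarrow> nat \<Rightarrow> (real^2) set \<Rightarrow> (real^2) set \<Rightarrow> bool" where
  "admissible_pair m n P Q \<longleftrightarrow>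
     finite P \<and> finite Q \<and> P \<inter> Q = {} \<and> card P = m \<and> card Q = n \<and> \<not> collinear (P \<union> Q)"

text \<open>\<open>LEAST\<close> is the minimum whenever an admissible pair exists, and is unspecified otherwise (for
  instance when \<open>m + n < 3\<close>); unlike \<open>Inf\<close> on \<open>nat\<close>, it does not silently become \<open>0\<close> there.\<close>

definition min_bipartite_angles :: "nat \<Rightarrow> nat \<Rightarrow> nat" where
  "min_bipartite_angles m n =
     (LEAST k. \<exists>P Q. admissible_pair m n P Q \<and> k = num_bipartite_angles P Q)"

end

theory Submission
  imports Defs
begin

text \<open>
  Put \<open>\<theta> = \<pi> / (m + 1)\<close>. Let \<open>P\<close> consist of the \<open>m\<close> points where the rays from the origin in the
  directions \<open>\<theta>, 2\<theta>, \<dots>, m\<theta>\<close> meet the line \<open>y = 1\<close>, and let \<open>Q\<close> consist of the origin and \<open>n - 1\<close>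
  further points of that line. Every segment joining a point of \<open>P\<close> to a point of \<open>Q\<close> then has a
  direction that is an integer multiple of \<open>\<theta>\<close> (the horizontal ones because \<open>\<pi>\<close> is such a multiple),
  so every angle in question is one of \<open>\<theta>, 2\<theta>, \<dots>, m\<theta>\<close>.
\<close>

definition dir :: "real \<Rightarrow> real^2" where
  "dir t = vector [cos t, sin t]"

lemma dir_inner: "dir s \<bullet> dir t = cos (s - t)"
  by (simp add: dir_def inner_vec_def sum_2 cos_diff)

lemma norm_dir [simp]: "norm (dir t) = 1"
  by (simp add: norm_eq_sqrt_inner dir_inner)

lemma dir_plus_pi: "dir (t + pi) = - dir t"
  by (simp add: dir_def vec_eq_iff forall_2)

lemma angle_at_dir:
  assumes "a - c = s *\<^sub>R dir x" "b - c = t *\<^sub>R dir y" "s > 0" "t > 0"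
  shows "angle_at a c b = arccos (cos (x - y))"
  using assms by (simp add: angle_at_def dir_inner)

text \<open>Periodicity of cosine reduces \<open>j\<close> modulo \<open>2 * N\<close>. A remainder
  above \<open>N\<close> is reflected to \<open>2 * N - r\<close>, which keeps the cosine and lands
  in [0, \<pi>], where \<open>arccos\<close> inverts \<open>cos\<close>.\<close>

lemma arccos_cos_multiple:
  fixes j :: int and N :: nat
  assumes "N > 0"
  obtains k :: nat where "arccos (cos (of_int j * (pi / N))) = k * (pi / N)"
proof -
  define r where "r = j mod (2 * int N)"
  have r: "0 \<le> r" "r < 2 * int N"
    using assms by (auto simp: r_def)
  define q where "q = j div (2 * int N)"
  have "j = 2 * int N * q + r"
    by (simp add: q_def r_def)
  then have "of_int j * (pi / N) = of_int r * (pi / N) + 2 * pi * of_int q"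
    using assms by (simp add: field_simps)
  then have c: "cos (of_int j * (pi / N)) = cos (of_int r * (pi / N))"
    by (simp add: cos_add)
  show thesis
  proof (cases "r \<le> int N")
    case True
    then have "of_int r * (pi / N) \<le> pi"
      using assms by (simp add: divide_simps)
    then have "arccos (cos (of_int r * (pi / N))) = of_int r * (pi / N)"
      using r by (intro arccos_cos) auto
    then show ?thesis
      using that[of "nat r"] c r by simp
  next
    case False
    have e: "of_int r * (pi / N) = 2 * pi - of_int (2 * int N - r) * (pi / N)"
      using assms by (simp add: field_simps)
    have "of_int (2 * int N - r) * (pi / N) \<le> pi"
      using assms False by (simp add: divide_simps)
    moreover have "0 \<le> of_int (2 * int N - r) * (pi / N)"
      using r by (intro mult_nonneg_nonneg) auto
    ultimately have "arccos (cos (of_int r * (pi / N))) = of_int (2 * int N - r) * (pi / N)"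
      unfolding e cos_2pi_minus by (intro arccos_cos)
    then show ?thesis
      using that[of "nat (2 * int N - r)"] c r by simp
  qed
qed

text \<open>The factor \<open>s\<close> is positive because angles are measured between rays, not
  lines. All integers \<open>j\<close> are allowed, so that opposite and differing directions stay
  in the same family.\<close>

definition lattice_directions :: "nat \<Rightarrow> (real^2) set \<Rightarrow> (real^2) set \<Rightarrow> bool" where
  "lattice_directions N C E \<longleftrightarrow>
     (\<forall>c\<in>C. \<forall>e\<in>E. \<exists>s>0. \<exists>j::int. e - c = s *\<^sub>R dir (of_int j * (pi / N)))"

text \<open>Reversing a segment turns its direction by \<pi>, which is \<open>N\<close> lattice
  steps. Hence one orientation controls the angles centred in either set.\<close>

lemma lattice_directions_sym:
  assumes "N > 0" "lattice_directions N C E"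
  shows "lattice_directions N E C"
  unfolding lattice_directions_def
proof (intro ballI)
  fix e c assume "e \<in> E" "c \<in> C"
  then obtain s j where s: "s > 0" "e - c = s *\<^sub>R dir (of_int j * (pi / N))"
    using assms(2) unfolding lattice_directions_def by blast
  have "of_int (j + int N) * (pi / N) = of_int j * (pi / N) + pi"
    using assms(1) by (simp add: field_simps)
  then have "c - e = s *\<^sub>R dir (of_int (j + int N) * (pi / N))"
    using s(2) by (metis dir_plus_pi minus_diff_eq scaleR_minus_right)
  with s(1) show "\<exists>s>0. \<exists>j::int. c - e = s *\<^sub>R dir (of_int j * (pi / N))"
    by blast
qed

lemma centred_angles_lattice:
  assumes "N > 0" "lattice_directions N C E"
  shows "centred_angles C E \<subseteq> range (\<lambda>k::nat. k * (pi / N))"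
proof
  fix t assume "t \<in> centred_angles C E"
  then obtain a c b where t: "t = angle_at a c b" "c \<in> C" "a \<in> E" "b \<in> E"
    unfolding centred_angles_def by blast
  then obtain s i s' j where dirs:
    "s > 0" "a - c = s *\<^sub>R dir (of_int i * (pi / N))"
    "s' > 0" "b - c = s' *\<^sub>R dir (of_int j * (pi / N))"
    using assms(2) unfolding lattice_directions_def by blast
  have "t = arccos (cos (of_int (i - j) * (pi / N)))"
    unfolding t(1) angle_at_dir[OF dirs(2,4,1,3)] by (simp add: left_diff_distrib diff_divide_distrib)
  then show "t \<in> range (\<lambda>k::nat. k * (pi / N))"
    using arccos_cos_multiple[OF assms(1), of "i - j"] by (metis rangeI)
qed

text \<open>Only the multiples 1, ..., \<open>m\<close> of \<pi> / (m + 1) lie strictly between 0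
  and \<pi>.\<close>

lemma num_bipartite_angles_lattice:
  assumes "lattice_directions (Suc m) P Q"
  shows "num_bipartite_angles P Q \<le> m"
proof -
  have "(centred_angles P Q \<union> centred_angles Q P) \<inter> {0<..<pi}
      \<subseteq> (\<lambda>k::nat. k * (pi / Suc m)) ` {1..m}"
  proof
    fix t assume t: "t \<in> (centred_angles P Q \<union> centred_angles Q P) \<inter> {0<..<pi}"
    then have "t \<in> range (\<lambda>k::nat. k * (pi / Suc m))"
      using centred_angles_lattice[of "Suc m"] lattice_directions_sym[of "Suc m"] assms by blast
    then obtain k :: nat where k: "t = k * (pi / Suc m)"
      by blast
    with t have "0 < real k * (pi / Suc m)" "real k * (pi / Suc m) < pi"
      by auto
    then have "0 < k" "k < Suc m"
      by (auto intro: gr0I simp: divide_simps simp del: of_nat_Suc)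
    then have "k \<in> {1..m}"
      by auto
    with k show "t \<in> (\<lambda>k::nat. k * (pi / Suc m)) ` {1..m}"
      by blast
  qed
  then have "num_bipartite_angles P Q \<le> card ((\<lambda>k::nat. k * (pi / Suc m)) ` {1..m})"
    unfolding num_bipartite_angles_def by (intro card_mono) auto
  also have "\<dots> \<le> card {1..m}"
    by (rule card_image_le) simp
  finally show ?thesis
    by simp
qed

definition line_pt :: "real \<Rightarrow> real^2" where
  "line_pt x = vector [x, 1]"

lemma line_pt_component [simp]: "line_pt x $ 1 = x" "line_pt x $ 2 = 1"
  by (simp_all add: line_pt_def)

lemma inj_line_pt: "inj line_pt"
  by (metis injI line_pt_component(1))

text \<open>The line through the origin in direction \<open>t\<close> meets y = 1 at abscissa
  \<open>cot t\<close>; when \<open>sin t > 0\<close>, the ray itself does.\<close>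

lemma line_pt_cot:
  assumes "sin t \<noteq> 0"
  shows "line_pt (cot t) = (1 / sin t) *\<^sub>R dir t"
  using assms by (simp add: vec_eq_iff forall_2 dir_def cot_def)

lemma line_pt_diff: "line_pt x - line_pt y = (x - y) *\<^sub>R dir 0"
  by (simp add: vec_eq_iff forall_2 dir_def)

text \<open>A common direction \<open>u\<close> would need a nonzero vertical component to join the
  origin to height 1, but a zero one to join two distinct points of that height.\<close>

lemma not_collinear_line_pts:
  assumes "0 \<in> S" "line_pt x \<in> S" "line_pt y \<in> S" "x \<noteq> y"
  shows "\<not> collinear S"
proof
  assume "collinear S"
  then obtain u where u: "\<forall>v\<in>S. \<forall>w\<in>S. \<exists>c. v - w = c *\<^sub>R u"
    unfolding collinear_def by blast
  then obtain c d where "line_pt x - 0 = c *\<^sub>R u" "line_pt x - line_pt y = d *\<^sub>R u"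
    using assms by meson
  then have "1 = c * u $ 2" "0 = d * u $ 2" "x - y = d * u $ 1"
    by (auto simp: vec_eq_iff forall_2)
  with assms(4) show False
    by auto
qed

lemma lattice_pair_exists:
  assumes "1 \<le> m" "2 \<le> n"
  obtains P Q where "admissible_pair m n P Q" "lattice_directions (Suc m) P Q"
proof -
  define \<theta> where "\<theta> = pi / Suc m"
  define X where "X = (\<lambda>k::nat. cot (k * \<theta>)) ` {1..m}"
  have range: "0 < k * \<theta>" "k * \<theta> < pi" if "k \<in> {1..m}" for k :: nat
    using that by (auto simp: \<theta>_def divide_simps)
  then have sin: "sin (k * \<theta>) > 0" if "k \<in> {1..m}" for k :: nat
    using that by (intro sin_gt_zero) auto
  have "inj_on (\<lambda>k::nat. cot (k * \<theta>)) {1..m}"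
  proof (rule inj_onI)
    fix j k :: nat
    assume jk: "j \<in> {1..m}" "k \<in> {1..m}" "cot (j * \<theta>) = cot (k * \<theta>)"
    then have "cos (j * \<theta>) * sin (k * \<theta>) = cos (k * \<theta>) * sin (j * \<theta>)"
      using sin[OF jk(1)] sin[OF jk(2)] by (simp add: cot_def frac_eq_eq)
    then have sin0: "sin (j * \<theta> - k * \<theta>) = 0"
      by (simp add: sin_diff)
    \<comment> \<open>Both angles lie in (0, \<pi>), so their difference lies in (-\<pi>, \<pi>),
      where sine vanishes only at 0.\<close>
    have "j * \<theta> - k * \<theta> = 0"
      by (rule sin_eq_0_pi[OF _ _ sin0]) (use range[OF jk(1)] range[OF jk(2)] in linarith)+
    then show "j = k"
      by (simp add: \<theta>_def)
  qed
  then have X: "finite X" "card X = m"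
    by (simp_all add: X_def card_image)
  \<comment> \<open>The remaining \<open>n - 1\<close> abscissae are arbitrary reals outside
    \<open>X\<close>; avoiding \<open>X\<close> makes \<open>P\<close> and \<open>Q\<close>
    disjoint.\<close>
  have "infinite (- X)"
    using X(1) infinite_UNIV_char_0 by (simp add: finite_compl)
  then obtain Y where Y: "finite Y" "card Y = n - 1" "Y \<subseteq> - X"
    using infinite_arbitrarily_large by blast
  define P where "P = line_pt ` X"
  define Q where "Q = insert 0 (line_pt ` Y)"
  have zero: "0 \<noteq> line_pt x" "line_pt x \<noteq> 0" for x
    by (auto simp: vec_eq_iff forall_2)
  have "card P = m"
    using X inj_line_pt by (simp add: P_def card_image inj_on_subset)
  moreover have "card Q = n"
    using Y assms zero inj_line_pt by (auto simp: Q_def card_image inj_on_subset card_insert_if)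
  moreover have "P \<inter> Q = {}"
    using Y zero inj_line_pt by (auto simp: P_def Q_def dest: injD)
  moreover have "\<not> collinear (P \<union> Q)"
  proof -
    \<comment> \<open>Here \<open>2 \<le> n\<close> matters: it leaves \<open>Q\<close> a point on
      the line besides the origin.\<close>
    have "X \<noteq> {}" "Y \<noteq> {}"
      using X Y assms by auto
    then obtain x y where "x \<in> X" "y \<in> Y"
      by blast
    then show ?thesis
      using Y by (intro not_collinear_line_pts[of _ x y]) (auto simp: P_def Q_def)
  qed
  ultimately have "admissible_pair m n P Q"
    using X Y by (simp add: admissible_pair_def P_def Q_def)
  moreover have "lattice_directions (Suc m) P Q"
    unfolding lattice_directions_def \<theta>_def[symmetric]
  proof (intro ballI)
    fix p q assume "p \<in> P" "q \<in> Q"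
    then obtain k :: nat where k: "k \<in> {1..m}" "p = line_pt (cot (k * \<theta>))"
      by (auto simp: P_def X_def)
    have pi: "Suc m * \<theta> = pi"
      by (simp add: \<theta>_def del: of_nat_Suc)
    consider "q = 0" | y where "y \<in> Y" "q = line_pt y"
      using \<open>q \<in> Q\<close> by (auto simp: Q_def)
    then show "\<exists>s>0. \<exists>j::int. q - p = s *\<^sub>R dir (of_int j * \<theta>)"
    proof cases
      case 1
      \<comment> \<open>The vector from \<open>p\<close> to the origin is opposite to the ray
        through \<open>p\<close>, hence the shift by \<open>Suc m\<close> steps.\<close>
      have "of_int (int (k + Suc m)) * \<theta> = k * \<theta> + pi"
        unfolding pi[symmetric] by (simp add: distrib_right)
      then have "q - p = (1 / sin (k * \<theta>)) *\<^sub>R dir (of_int (int (k + Suc m)) * \<theta>)"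
        using 1 k sin[OF k(1)] by (simp add: line_pt_cot dir_plus_pi del: of_nat_add of_nat_Suc)
      moreover have "1 / sin (k * \<theta>) > 0"
        using sin[OF k(1)] by simp
      ultimately show ?thesis
        by blast
    next
      case 2
      define d where "d = y - cot (k * \<theta>)"
      have qp: "q - p = d *\<^sub>R dir 0"
        by (simp add: 2 k line_pt_diff d_def)
      have "d \<noteq> 0"
        using 2 Y k by (auto simp: d_def X_def)
      then consider "d > 0" | "d < 0"
        by linarith
      then show ?thesis
      proof cases
        case 1
        then show ?thesis
          using qp by (intro exI[of _ d] conjI exI[of _ 0]) auto
      next
        case 2
        \<comment> \<open>If \<open>q\<close> lies to the left of \<open>p\<close>, the direction is
          \<pi>, the multiple \<open>Suc m\<close> of \<theta>.\<close>
        have "dir (of_int (int (Suc m)) * \<theta>) = - dir 0"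
          using dir_plus_pi[of 0] pi by simp
        with 2 qp show ?thesis
          by (intro exI[of _ "- d"] conjI exI[of _ "int (Suc m)"]) auto
      qed
    qed
  qed
  ultimately show thesis
    using that by blast
qed

theorem lemma5p2:
  fixes m n :: nat
  assumes "1 \<le> m" and "m \<le> n" and "3 \<le> m + n"
  shows "min_bipartite_angles m n \<le> m"
proof -
  \<comment> \<open>\<open>m \<le> n\<close> and \<open>3 \<le> m + n\<close> together force
    \<open>2 \<le> n\<close>.\<close>
  obtain P Q where PQ: "admissible_pair m n P Q" "lattice_directions (Suc m) P Q"
    using lattice_pair_exists[of m n] assms by auto
  then have "min_bipartite_angles m n \<le> num_bipartite_angles P Q"
    unfolding min_bipartite_angles_def by (intro Least_le) blast
  also have "\<dots> \<le> m"
    using PQ(2) by (rule num_bipartite_angles_lattice)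
  finally show ?thesis .
qed

end
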